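(* Let $(r,\rho)\in\mathfrak A$ with $r\in\mathbb Q$, and let $\gamma_{r,\rho}:\mathbb R\to\mathcal S$ be the symmetrical configuration of the first kind with parameters $(r,\rho)$. Then $\gamma_{r,\rho}$ is an isoparametric knot of the first class, with spectral ratio $r$. Moreover, the trajectory of $\gamma_{r,\rho}$ is a negative torus knot of type $(p,q)$, where $p>0$ and $q<0$ are, respectively, the numerator and the denominator (in lowest terms) of $\frac{2+r}{1+2r}$. The trajectory of $\gamma_{r,\rho}$ is contained in the standard Heisenberg cyclide $\mathcal T_\rho$ with parameter $\rho$.
   Context: $\mathbb C^{2,1}$ is $\mathbb C^3$ with the Hermitian form $\langle \mathbf z,\mathbf w\rangle={}^t\overline{\mathbf z}\,\mathbf h\,\mathbf w$, $\mathbf h=\begin{pmatrix}0&0&i\\0&1&0\\-i&0&0\end{pmatrix}$. $\mathcal N$ is the set of nonzero null vectors, $\mathcal S=\{[\mathbf z]\in\mathbb{CP}^2:\langle\mathbf z,\mathbf z\rangle=0\}$, with contact form $\zeta$ equal to the restriction to $T\mathcal S$ of $-i\langle\mathbf z,d\mathbf z\rangle/({}^t\overline{\mathbf z}\mathbf z)$. $G=\{A\in SL(3,\mathbb C):{}^t\bar A\mathbf hA=\mathbf h\}$ acts on $\mathcal S$ by $A[\mathbf z]=[A\mathbf z]$. Curves. A lift of a smooth curve $\gamma:\mathbb R\to\mathcal S$ is a smooth $\Gamma:\mathbb R\to\mathcal N$ with $\gamma=[\Gamma]$. $\gamma$ is transversal if $\zeta(\gamma')\neq0$ everywhere; transversal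 curves are positively parametrized, $-i\langle\Gamma,\Gamma'\rangle>0$. It is generic if $\det(\Gamma,\Gamma',\Gamma'')$ never vanishes. A Wilczynski lift has $\det(\Gamma,\Gamma',\Gamma'')=-1$; the parametrization is natural if moreover $i\langle\Gamma,\Gamma'\rangle^{-1}=1$, and then bending and twist are $\kappa=\frac12\langle\Gamma',\Gamma'\rangle$, $\tau=\mathrm{Im}\langle\Gamma'',\Gamma'\rangle+3\kappa^2$. A generic transversal curve is isoparametric if $\kappa,\tau$ are constant; an isoparametric string is a closed (periodic) isoparametric curve; it is an isoparametric knot if it is injective on $[0,\omega)$, $\omega$ being its minimal period. Let $\mathrm H_{\kappa,\tau}=i\begin{pmatrix}i\kappa&-i&\tau\\0&-2i\kappa&1\\1&0&i\kappa\end{pmatrix}$ and $D_{\kappa,\tau}=-27+108\kappa(\kappa^2+\tau)-324\kappa^4\tau-72\kappa^2\tau^2-4\tau^3$ (discriminant of its characteristic polynomial). For isoparametric strings $D_{\kappa,\tau}>0$, $\mathrm H_{\kappa,\tau}$ has real eigenvalues $e_1<e_2<e_3$ with sum $0$, and the spectral ratio is $e_1/e_3\in(-2,-1/2)\cap\mathbb Q$. The string is of the first class if $3\kappa>|\tau|^{1/2}$, of the second class if $3\kappa<|\tau|^{1/2}$. Symmetrical configurations of the first kind. Let $$\mathfrak A=\Big\{(r,\rho)\in(-2,-\tfrac12)\times(0,\sqrt2):\rho<\sqrt{\tfrac{2(-3+2\sqrt{2-r-r^2})}{1+2r}}\Big\},$$ $$\mu_1(r,\rho)=\frac{4+8r+12\rho^2+(1+2r)\rho^4}{4+8r+12\rho^2+(1+2r)\rho^4-2\big((2+3r-3r^2-2r^3)(-4\rho+\rho^5)\big)^{2/3}}\in(0,1),$$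 $e_1^1=r\frac{\mu_1}{1-\mu_1}$, $e_1^2=-(1+r)\frac{\mu_1}{1-\mu_1}$, $e_1^3=\frac{\mu_1}{1-\mu_1}$, $D_1(r,\rho)=\mathrm{diag}(-ie_1^2,-ie_1^3,-ie_1^1)$, $\mathcal U=\begin{pmatrix}\frac1{\sqrt2}&0&\frac i{\sqrt2}\\0&1&0\\\frac i{\sqrt2}&0&\frac1{\sqrt2}\end{pmatrix}$, $S(\rho)=[{}^t(1,\rho,i\rho^2/2)]\in\mathcal S$. For $(r,\rho)\in\mathfrak A$, $r\in\mathbb Q$, the symmetrical configuration of the first kind with parameters $(r,\rho)$ is $\gamma_{r,\rho}(s)=\big(\mathcal U\exp(sD_1(r,\rho))\,\mathcal U^{-1}\big)S(\rho)$. Cyclides and torus knots. For $\theta_1,\theta_2\in\mathbb R$ let $$R(\theta_1,\theta_2)=\begin{pmatrix}e^{-\frac i6(\theta_1+2\theta_2)}\cos\frac{\theta_1}2&0&e^{-\frac i6(\theta_1+2\theta_2)}\sin\frac{\theta_1}2\\0&e^{\frac i3(\theta_1+2\theta_2)}&0\\-e^{-\frac i6(\theta_1+2\theta_2)}\sin\frac{\theta_1}2&0&e^{-\frac i6(\theta_1+2\theta_2)}\cos\frac{\theta_1}2\end{pmatrix}\in G.$$ These form a torus $\mathrm T^2\subset G$; for $\rho\in(0,\sqrt2)$ the standard Heisenberg cyclide $\mathcal T_\rho$ is the $\mathrm T^2$-orbit of $S(\rho)$, an embedded 2-torus parametrized by $(\theta_1,\theta_2)\in(\mathbb R/2\pi\mathbb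 Z)^2$ via $R(\theta_1,\theta_2)S(\rho)$. Under the Heisenberg projection $[\mathbf z]\mapsto(\mathrm{Re}(z_2/z_1),\mathrm{Im}(z_2/z_1),\mathrm{Re}(z_3/z_1))$ from $\mathcal S\setminus\{[{}^t(0,0,1)]\}$ onto $\mathbb R^3$, $R(0,\theta_2)$ is the counterclockwise rotation by $\theta_2$ about the $z$-axis and $R(\theta_1,0)$ rotates around the Clifford circle $x^2+y^2=2,\ z=0$. A simple closed curve on $\mathcal T_\rho$ along which $\theta_1,\theta_2$ are linear in the parameter is a torus knot of type $(p,q)$, $p,q$ coprime, if $p/q=-\theta_2'/\theta_1'$ (it winds $|p|$ times around the $z$-axis and $|q|$ times around the Clifford circle); it is positive if $pq>0$ and negative if $pq<0$. *)

theory Defs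
  imports "HOL-Analysis.Analysis"
begin

section \<open>The Hermitian space and the projective plane\<close>

definition mat_h :: "complex^3^3" where
  "mat_h = vector [vector [0, 0, \<i>], vector [0, 1, 0], vector [- \<i>, 0, 0]]"

text \<open>Conjugate-linear in the first argument.\<close>

definition herm :: "complex^3 \<Rightarrow> complex^3 \<Rightarrow> complex" where
  "herm z w = (\<Sum>i\<in>UNIV. cnj (z $ i) * (mat_h *v w) $ i)"

definition null_vectors :: "(complex^3) set" where
  "null_vectors = {z. z \<noteq> 0 \<and> herm z z = 0}"

text \<open>Points of the complex projective plane are the complex lines through the origin,
  so that the projective action of an invertible matrix is the direct image.\<close>

type_synonym point = "(complex^3) set"

definition proj :: "complex^3 \<Rightarrow> point" where
  "proj z = {c *s z | c. True}"

definition act :: "complex^3^3 \<Rightarrow> point \<Rightarrow> point" where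
  "act A L = (\<lambda>v. A *v v) ` L"

definition CR_sphere :: "point set" where
  "CR_sphere = {proj z | z. z \<noteq> 0 \<and> herm z z = 0}"


section \<open>Smooth curves and lifts\<close>

definition vderiv :: "(real \<Rightarrow> 'a::real_normed_vector) \<Rightarrow> real \<Rightarrow> 'a" where
  "vderiv f = (\<lambda>t. vector_derivative f (at t))"

text \<open>Used for open domains only.\<close>

definition smooth_curve_on :: "real set \<Rightarrow> (real \<Rightarrow> 'a::real_normed_vector) \<Rightarrow> bool" where
  "smooth_curve_on T f \<longleftrightarrow> (\<forall>n. \<forall>t\<in>T. (vderiv ^^ n) f differentiable (at t))"

text \<open>The standard affine charts: the \<open>j\<close>-th one is defined on the lines not contained in the
  hyperplane \<open>z $ j = 0\<close> and takes such a line to its representative with \<open>j\<close>-th coordinate 1.\<close>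

definition chart_dom :: "3 \<Rightarrow> point set" where
  "chart_dom j = {proj z | z. z $ j \<noteq> 0}"

definition chart :: "3 \<Rightarrow> point \<Rightarrow> complex^3" where
  "chart j L = (THE v. v \<in> L \<and> v $ j = 1)"

text \<open>Openness of the preimages of the chart domains is the continuity requirement.\<close>

definition smooth_curve_in_sphere :: "(real \<Rightarrow> point) \<Rightarrow> bool" where
  "smooth_curve_in_sphere \<gamma> \<longleftrightarrow>
     (\<forall>t. \<gamma> t \<in> CR_sphere) \<and>
     (\<forall>j. open {t. \<gamma> t \<in> chart_dom j} \<and>
          smooth_curve_on {t. \<gamma> t \<in> chart_dom j} (\<lambda>t. chart j (\<gamma> t)))"

definition is_lift :: "(real \<Rightarrow> complex^3) \<Rightarrow> (real \<Rightarrow> point) \<Rightarrow> bool" where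
  "is_lift \<Gamma> \<gamma> \<longleftrightarrow>
     smooth_curve_on UNIV \<Gamma> \<and> (\<forall>t. \<Gamma> t \<in> null_vectors \<and> \<gamma> t = proj (\<Gamma> t))"

definition det3 :: "complex^3 \<Rightarrow> complex^3 \<Rightarrow> complex^3 \<Rightarrow> complex" where
  "det3 a b c = det (transpose (vector [a, b, c]) :: complex^3^3)"


section \<open>Transversal curves, bending and twist\<close>

text \<open>The contact form on the tangent vector represented by \<open>v\<close> at the point represented by \<open>z\<close>.\<close>

definition contact_form :: "complex^3 \<Rightarrow> complex^3 \<Rightarrow> complex" where
  "contact_form z v = - \<i> * herm z v / (\<Sum>i\<in>UNIV. cnj (z $ i) * z $ i)"

text \<open>The conditions in the next three definitions do not depend on the lift, and every smooth
  curve in the sphere has a lift. The number whose real part is taken in the second one is real,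
  because \<open>\<Gamma>\<close> takes values in the null vectors.\<close>

definition transversal :: "(real \<Rightarrow> point) \<Rightarrow> bool" where
  "transversal \<gamma> \<longleftrightarrow> smooth_curve_in_sphere \<gamma> \<and>
     (\<exists>\<Gamma>. is_lift \<Gamma> \<gamma> \<and> (\<forall>t. contact_form (\<Gamma> t) (vderiv \<Gamma> t) \<noteq> 0))"

definition positively_parametrized :: "(real \<Rightarrow> point) \<Rightarrow> bool" where
  "positively_parametrized \<gamma> \<longleftrightarrow>
     (\<exists>\<Gamma>. is_lift \<Gamma> \<gamma> \<and> (\<forall>t. Re (- \<i> * herm (\<Gamma> t) (vderiv \<Gamma> t)) > 0))"

definition generic :: "(real \<Rightarrow> point) \<Rightarrow> bool" where
  "generic \<gamma> \<longleftrightarrow>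
     (\<exists>\<Gamma>. is_lift \<Gamma> \<gamma> \<and> (\<forall>t. det3 (\<Gamma> t) (vderiv \<Gamma> t) (vderiv (vderiv \<Gamma>) t) \<noteq> 0))"

definition wilczynski_lift :: "(real \<Rightarrow> complex^3) \<Rightarrow> (real \<Rightarrow> point) \<Rightarrow> bool" where
  "wilczynski_lift \<Gamma> \<gamma> \<longleftrightarrow> is_lift \<Gamma> \<gamma> \<and>
     (\<forall>t. det3 (\<Gamma> t) (vderiv \<Gamma> t) (vderiv (vderiv \<Gamma>) t) = -1)"

text \<open>\<open>\<gamma>\<close> is naturally parametrized, with bending \<open>\<kappa>\<close> and twist \<open>\<tau>\<close>. A Wilczynski lift is unique up
  to a cube root of unity, so \<open>\<kappa>\<close> and \<open>\<tau>\<close> are determined by \<open>\<gamma>\<close>.\<close>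

definition natural_with_bending_twist ::
    "(real \<Rightarrow> point) \<Rightarrow> (real \<Rightarrow> real) \<Rightarrow> (real \<Rightarrow> real) \<Rightarrow> bool" where
  "natural_with_bending_twist \<gamma> \<kappa> \<tau> \<longleftrightarrow>
     (\<exists>\<Gamma>. wilczynski_lift \<Gamma> \<gamma> \<and>
       (\<forall>t. \<i> * inverse (herm (\<Gamma> t) (vderiv \<Gamma> t)) = 1 \<and>
            of_real (\<kappa> t) = 1/2 * herm (vderiv \<Gamma> t) (vderiv \<Gamma> t) \<and>
            \<tau> t = Im (herm (vderiv (vderiv \<Gamma>) t) (vderiv \<Gamma> t)) + 3 * (\<kappa> t)\<^sup>2))"

definition isoparametric :: "(real \<Rightarrow> point) \<Rightarrow> real \<Rightarrow> real \<Rightarrow> bool" where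
  "isoparametric \<gamma> \<kappa> \<tau> \<longleftrightarrow>
     transversal \<gamma> \<and> positively_parametrized \<gamma> \<and> generic \<gamma> \<and>
     natural_with_bending_twist \<gamma> (\<lambda>_. \<kappa>) (\<lambda>_. \<tau>)"


section \<open>Isoparametric strings and knots\<close>

definition minimal_period :: "(real \<Rightarrow> 'a) \<Rightarrow> real \<Rightarrow> bool" where
  "minimal_period f \<omega> \<longleftrightarrow>
     \<omega> > 0 \<and> (\<forall>s. f (s + \<omega>) = f s) \<and>
     (\<forall>\<omega>'. 0 < \<omega>' \<and> (\<forall>s. f (s + \<omega>') = f s) \<longrightarrow> \<omega> \<le> \<omega>')"

definition simple_closed :: "(real \<Rightarrow> 'a) \<Rightarrow> bool" where
  "simple_closed f \<longleftrightarrow> (\<exists>\<omega>. minimal_period f \<omega> \<and> inj_on f {0..<\<omega>})"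

definition isoparametric_string :: "(real \<Rightarrow> point) \<Rightarrow> bool" where
  "isoparametric_string \<gamma> \<longleftrightarrow>
     (\<exists>\<kappa> \<tau>. isoparametric \<gamma> \<kappa> \<tau>) \<and> (\<exists>\<omega>>0. \<forall>s. \<gamma> (s + \<omega>) = \<gamma> s)"

definition isoparametric_knot :: "(real \<Rightarrow> point) \<Rightarrow> bool" where
  "isoparametric_knot \<gamma> \<longleftrightarrow> isoparametric_string \<gamma> \<and> simple_closed \<gamma>"

definition first_class :: "(real \<Rightarrow> point) \<Rightarrow> bool" where
  "first_class \<gamma> \<longleftrightarrow> isoparametric_string \<gamma> \<and>
     (\<exists>\<kappa> \<tau>. isoparametric \<gamma> \<kappa> \<tau> \<and> 3 * \<kappa> > sqrt \<bar>\<tau>\<bar>)"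

definition mat_H :: "real \<Rightarrow> real \<Rightarrow> complex^3^3" where
  "mat_H \<kappa> \<tau> = (\<chi> i j. \<i> *
     (vector [vector [\<i> * of_real \<kappa>, - \<i>, of_real \<tau>],
              vector [0, - 2 * \<i> * of_real \<kappa>, 1],
              vector [1, 0, \<i> * of_real \<kappa>]] :: complex^3^3) $ i $ j)"

definition eigenvalues :: "complex^3^3 \<Rightarrow> complex set" where
  "eigenvalues A = {e. \<exists>v. v \<noteq> 0 \<and> A *v v = e *s v}"

definition has_spectral_ratio :: "(real \<Rightarrow> point) \<Rightarrow> real \<Rightarrow> bool" where
  "has_spectral_ratio \<gamma> r \<longleftrightarrow> isoparametric_string \<gamma> \<and>
     (\<exists>\<kappa> \<tau> e1 e2 e3 :: real. isoparametric \<gamma> \<kappa> \<tau> \<and> e1 < e2 \<and> e2 < e3 \<and>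
        eigenvalues (mat_H \<kappa> \<tau>) = {of_real e1, of_real e2, of_real e3} \<and> r = e1 / e3)"


section \<open>Symmetrical configurations of the first kind\<close>

definition frakA :: "(real \<times> real) set" where
  "frakA = {(r, \<rho>). -2 < r \<and> r < -1/2 \<and> 0 < \<rho> \<and> \<rho> < sqrt 2 \<and>
     \<rho> < sqrt (2 * (-3 + 2 * sqrt (2 - r - r\<^sup>2)) / (1 + 2 * r))}"

definition mu1 :: "real \<Rightarrow> real \<Rightarrow> real" where
  "mu1 r \<rho> =
     (4 + 8 * r + 12 * \<rho>^2 + (1 + 2 * r) * \<rho>^4) /
     (4 + 8 * r + 12 * \<rho>^2 + (1 + 2 * r) * \<rho>^4
       - 2 * ((2 + 3 * r - 3 * r^2 - 2 * r^3) * (- 4 * \<rho> + \<rho>^5)) powr (2/3))"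

definition diag3 :: "complex \<Rightarrow> complex \<Rightarrow> complex \<Rightarrow> complex^3^3" where
  "diag3 a b c = vector [vector [a, 0, 0], vector [0, b, 0], vector [0, 0, c]]"

definition e11 :: "real \<Rightarrow> real \<Rightarrow> real" where
  "e11 r \<rho> = r * (mu1 r \<rho> / (1 - mu1 r \<rho>))"

definition e12 :: "real \<Rightarrow> real \<Rightarrow> real" where
  "e12 r \<rho> = - (1 + r) * (mu1 r \<rho> / (1 - mu1 r \<rho>))"

definition e13 :: "real \<Rightarrow> real \<Rightarrow> real" where
  "e13 r \<rho> = mu1 r \<rho> / (1 - mu1 r \<rho>)"

definition mat_D1 :: "real \<Rightarrow> real \<Rightarrow> complex^3^3" where
  "mat_D1 r \<rho> = diag3 (- \<i> * of_real (e12 r \<rho>)) (- \<i> * of_real (e13 r \<rho>)) (- \<i> * of_real (e11 r \<rho>))"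

definition mat_U :: "complex^3^3" where
  "mat_U = vector
     [vector [1 / of_real (sqrt 2), 0, \<i> / of_real (sqrt 2)],
      vector [0, 1, 0],
      vector [\<i> / of_real (sqrt 2), 0, 1 / of_real (sqrt 2)]]"

definition matrix_exp :: "complex^3^3 \<Rightarrow> complex^3^3" where
  "matrix_exp A = (\<Sum>n. (1 / fact n) *\<^sub>R (((**) A) ^^ n) (mat 1))"

definition pt_S :: "real \<Rightarrow> point" where
  "pt_S \<rho> = proj (vector [1, of_real \<rho>, \<i> * of_real (\<rho>\<^sup>2) / 2])"

definition symm_config1 :: "real \<Rightarrow> real \<Rightarrow> real \<Rightarrow> point" where
  "symm_config1 r \<rho> s =
     act (mat_U ** matrix_exp (s *\<^sub>R mat_D1 r \<rho>) ** matrix_inv mat_U) (pt_S \<rho>)"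


section \<open>Heisenberg cyclides and torus knots\<close>

definition mat_R :: "real \<Rightarrow> real \<Rightarrow> complex^3^3" where
  "mat_R \<theta>1 \<theta>2 =
     (let u = exp (- (\<i> / 6) * of_real (\<theta>1 + 2 * \<theta>2));
          w = exp ((\<i> / 3) * of_real (\<theta>1 + 2 * \<theta>2));
          c = of_real (cos (\<theta>1 / 2));
          d = of_real (sin (\<theta>1 / 2))
      in vector [vector [u * c, 0, u * d], vector [0, w, 0], vector [- u * d, 0, u * c]])"

definition cyclide :: "real \<Rightarrow> point set" where
  "cyclide \<rho> = {act (mat_R \<theta>1 \<theta>2) (pt_S \<rho>) | \<theta>1 \<theta>2. True}"

text \<open>A simple closed curve on the cyclide, linear in the angles, of type \<open>(p, q)\<close>; \<open>a1\<close> and \<open>a2\<close> are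
  the derivatives of the two angles.\<close>

definition torus_knot_param :: "real \<Rightarrow> (real \<Rightarrow> point) \<Rightarrow> int \<Rightarrow> int \<Rightarrow> bool" where
  "torus_knot_param \<rho> c p q \<longleftrightarrow> simple_closed c \<and> coprime p q \<and> q \<noteq> 0 \<and>
     (\<exists>a1 a2 b1 b2 :: real. a1 \<noteq> 0 \<and>
        (\<forall>s. c s = act (mat_R (a1 * s + b1) (a2 * s + b2)) (pt_S \<rho>)) \<and>
        of_int p / of_int q = - a2 / a1)"

definition torus_knot :: "real \<Rightarrow> point set \<Rightarrow> int \<Rightarrow> int \<Rightarrow> bool" where
  "torus_knot \<rho> K p q \<longleftrightarrow> (\<exists>c. range c = K \<and> torus_knot_param \<rho> c p q)"

definition negative_torus_knot :: "real \<Rightarrow> point set \<Rightarrow> int \<Rightarrow> int \<Rightarrow> bool" where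
  "negative_torus_knot \<rho> K p q \<longleftrightarrow> torus_knot \<rho> K p q \<and> p * q < 0"

end

theory Submission
  imports Defs "HOL-Complex_Analysis.Cauchy_Integral_Formula"
begin

text \<open>The frame \<open>mat_U\<close> diagonalizes both the Hermitian form, into \<open>diag(-1, 1, 1)\<close>, and the torus of
  the matrices \<open>mat_R\<close>. In this frame the curve is the orbit \<open>b\<^sub>j exp(-i l\<^sub>j s)\<close> with
  \<open>l = (e12, e13, e11)\<close>, where \<open>b\<close> is any multiple of a representative of \<open>pt_S\<close>. The value of \<open>mu1\<close> is the
  one for which some real multiple gives a Wilczynski lift that is natural at the same time;
  bending and twist are then the moments \<open>\<Sum> \<plusminus>\<bar>b\<^sub>j\<bar>\<^sup>2 l\<^sub>j\<^sup>k\<close>, which identify the characteristic polynomial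
  of \<open>mat_H\<close> with the one whose roots are the \<open>l\<^sub>j\<close>. Closedness and injectivity are governed by the
  ratio \<open>(2 + r) / (1 + 2 r)\<close> of the phase differences \<open>l\<^sub>2 - l\<^sub>1\<close> and \<open>l\<^sub>3 - l\<^sub>1\<close>.\<close>

section \<open>Smooth curves\<close>

lemma has_vector_derivative_vec_lambda:
  fixes f :: "'i::finite \<Rightarrow> real \<Rightarrow> 'a::real_normed_vector"
  assumes "\<And>i. (f i has_vector_derivative f' i) (at t)"
  shows "((\<lambda>t. \<chi> i. f i t) has_vector_derivative (\<chi> i. f' i)) (at t)"
  unfolding has_vector_derivative_def has_derivative_within
proof (intro conjI vec_tendstoI)
  show "bounded_linear (\<lambda>x. x *\<^sub>R (\<chi> i. f' i))"
    by (rule bounded_linear_scaleR_left)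
next
  fix i
  have "((\<lambda>y. (1 / norm (y - t)) *\<^sub>R (f i y - (f i t + (y - t) *\<^sub>R f' i))) \<longlongrightarrow> 0) (at t)"
    using assms[of i] by (simp add: has_vector_derivative_def has_derivative_within)
  then show "((\<lambda>y. ((1 / norm (y - t)) *\<^sub>R
      ((\<chi> i. f i y) - ((\<chi> i. f i t) + (y - t) *\<^sub>R (\<chi> i. f' i)))) $ i) \<longlongrightarrow> 0 $ i) (at t)"
    by simp
qed

text \<open>Iterated real derivatives of the restriction are restrictions of the iterated complex
  derivatives, and holomorphic functions have all of those. This serves both for lifts and for their
  chart representations, where explicit higher derivatives of the quotients would be
  unwieldy.\<close>

lemma smooth_curve_on_holomorphic:
  fixes F :: "'i::finite \<Rightarrow> complex \<Rightarrow> complex" and f :: "real \<Rightarrow> complex^'i"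
  assumes T: "open T" and S: "open S" and TS: "of_real ` T \<subseteq> S"
    and F: "\<And>i. F i holomorphic_on S"
    and f: "\<And>t. t \<in> T \<Longrightarrow> f t = (\<chi> i. F i (of_real t))"
  shows "smooth_curve_on T f"
proof -
  have D: "((\<lambda>t. \<chi> i. (deriv ^^ n) (F i) (of_real t)) has_vector_derivative
      (\<chi> i. (deriv ^^ Suc n) (F i) (of_real t))) (at t)" if "t \<in> T" for n t
  proof (rule has_vector_derivative_vec_lambda)
    fix i
    have "(deriv ^^ n) (F i) holomorphic_on S"
      using F S by (rule holomorphic_higher_deriv)
    then have "((deriv ^^ n) (F i) has_field_derivative (deriv ^^ Suc n) (F i) (of_real t))
        (at (of_real t))"
      using holomorphic_derivI[OF _ S] TS that by auto
    then show "((\<lambda>t. (deriv ^^ n) (F i) (of_real t)) has_vector_derivative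
        (deriv ^^ Suc n) (F i) (of_real t)) (at t)"
      by (rule has_vector_derivative_real_field)
  qed
  \<comment> \<open>The formula for the iterate is known on \<open>T\<close> only, so openness of
    \<open>T\<close> is what transfers the derivative.\<close>
  have E: "((vderiv ^^ n) f has_vector_derivative (\<chi> i. (deriv ^^ Suc n) (F i) (of_real t))) (at t)"
    if "t \<in> T" "\<And>t. t \<in> T \<Longrightarrow> (vderiv ^^ n) f t = (\<chi> i. (deriv ^^ n) (F i) (of_real t))" for n t
    using D[OF that(1)] T that(1) by (rule has_vector_derivative_transform_within_open) (simp add: that(2))
  have I: "\<forall>t\<in>T. (vderiv ^^ n) f t = (\<chi> i. (deriv ^^ n) (F i) (of_real t))" for n
  proof (induction n)
    case 0
    then show ?case using f by simp
  next
    case (Suc n)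
    then have "(vderiv ^^ Suc n) f t = (\<chi> i. (deriv ^^ Suc n) (F i) (of_real t))" if "t \<in> T" for t
      using vector_derivative_at[OF E[of t n]] that by (simp add: vderiv_def[of "(vderiv ^^ n) f"])
    then show ?case by blast
  qed
  show ?thesis
    unfolding smooth_curve_on_def using E I differentiableI_vector by blast
qed

section \<open>Projective points\<close>

lemma proj_eq_image: "proj z = range (\<lambda>c. c *s z)"
  by (auto simp: proj_def)

lemma act_proj: "act A (proj z) = proj (A *v z)"
  by (simp add: act_def proj_eq_image image_image vector_scalar_commute)

lemma proj_smult:
  assumes "c \<noteq> 0"
  shows "proj (c *s z) = proj z"
proof -
  have "range (\<lambda>d. (d * c) *s z) = (\<lambda>d. d *s z) ` range (\<lambda>d. d * c)"
    by (simp add: image_image)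
  also have "range (\<lambda>d. d * c) = UNIV"
    using assms by (intro surjI[of _ "\<lambda>d. d / c"]) simp
  finally show ?thesis
    by (simp add: proj_eq_image vector_smult_assoc)
qed

lemma proj_eqD:
  assumes "proj z = proj w"
  obtains c where "z = c *s w"
proof -
  have "1 *s z \<in> proj w"
    unfolding assms[symmetric] by (auto simp only: proj_def)
  then show ?thesis using that by (auto simp: proj_def)
qed

lemma proj_in_chart_dom_iff:
  assumes "z \<noteq> 0"
  shows "proj z \<in> chart_dom j \<longleftrightarrow> z $ j \<noteq> 0"
proof
  assume "proj z \<in> chart_dom j"
  then obtain w where w: "proj w = proj z" "w $ j \<noteq> 0"
    by (auto simp: chart_dom_def)
  then obtain c where "w = c *s z"
    using proj_eqD by metis
  with w show "z $ j \<noteq> 0" by auto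
qed (auto simp: chart_dom_def)

lemma chart_proj:
  assumes "z $ j \<noteq> 0"
  shows "chart j (proj z) = (\<chi> i. z $ i / z $ j)"
  unfolding chart_def
proof (rule the_equality)
  show "(\<chi> i. z $ i / z $ j) \<in> proj z \<and> (\<chi> i. z $ i / z $ j) $ j = 1"
    using assms by (auto simp: proj_def vec_eq_iff intro!: exI[of _ "inverse (z $ j)"] simp: field_simps)
next
  fix v assume v: "v \<in> proj z \<and> v $ j = 1"
  then obtain c where c: "v = c *s z" by (auto simp: proj_def)
  with v assms have "c = 1 / z $ j" by (auto simp: field_simps)
  with c show "v = (\<chi> i. z $ i / z $ j)" by (simp add: vec_eq_iff)
qed

text \<open>In the \<open>j\<close>-th chart the curve has coordinates \<open>F i / F j\<close>,
  which are holomorphic off the zero set of \<open>F j\<close>; the complement of that set is open,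
  and its real trace is the set of times spent in the chart domain.\<close>

lemma smooth_curve_in_sphere_holomorphic:
  fixes F :: "3 \<Rightarrow> complex \<Rightarrow> complex"
  assumes F: "\<And>i. F i holomorphic_on UNIV"
    and \<Gamma>: "\<And>t. \<Gamma> t = (\<chi> i. F i (of_real t))"
    and null: "\<And>t. \<Gamma> t \<in> null_vectors" and \<gamma>: "\<And>t. \<gamma> t = proj (\<Gamma> t)"
  shows "is_lift \<Gamma> \<gamma>" "smooth_curve_in_sphere \<gamma>"
proof -
  show "is_lift \<Gamma> \<gamma>"
    using smooth_curve_on_holomorphic[of UNIV UNIV F \<Gamma>] F \<Gamma> null \<gamma> by (auto simp: is_lift_def)
  have dom: "{t. \<gamma> t \<in> chart_dom j} = of_real -` {z. F j z \<noteq> 0}" for j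
    using null by (auto simp: \<gamma> proj_in_chart_dom_iff null_vectors_def) (simp_all add: \<Gamma>)
  have op: "open {z. F j z \<noteq> 0}" for j
    by (rule open_Collect_neq[OF holomorphic_on_imp_continuous_on[OF F] continuous_on_const])
  have op': "open (complex_of_real -` {z. F j z \<noteq> 0})" for j
    by (rule open_vimage[OF op continuous_on_of_real_id])
  have "smooth_curve_on {t. \<gamma> t \<in> chart_dom j} (\<lambda>t. chart j (\<gamma> t))" for j
    unfolding dom
  proof (rule smooth_curve_on_holomorphic[OF op' op, where F="\<lambda>i z. F i z / F j z"])
    show "(\<lambda>z. F i z / F j z) holomorphic_on {z. F j z \<noteq> 0}" for i
      by (intro holomorphic_intros holomorphic_on_subset[OF F]) auto
  qed (auto simp: \<gamma> chart_proj \<Gamma>)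
  then show "smooth_curve_in_sphere \<gamma>"
    unfolding smooth_curve_in_sphere_def dom
    using op' null \<gamma> by (auto simp: CR_sphere_def null_vectors_def)
qed

section \<open>Diagonal matrices and the diagonalizing frame\<close>

lemma diag3_mult_vec: "diag3 a b c *v z = vector [a * z $ 1, b * z $ 2, c * z $ 3]"
  by (simp add: diag3_def vec_eq_iff forall_3 matrix_vector_mult_def sum_3)

lemma diag3_mult: "diag3 a b c ** diag3 a' b' c' = diag3 (a * a') (b * b') (c * c')"
  by (simp add: diag3_def vec_eq_iff forall_3 matrix_matrix_mult_def sum_3)

lemma matrix_exp_diag3: "matrix_exp (diag3 a b c) = diag3 (exp a) (exp b) (exp c)"
proof -
  have pow: "(((**) (diag3 a b c)) ^^ n) (mat 1) = diag3 (a ^ n) (b ^ n) (c ^ n)" for n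
  proof (induction n)
    case 0
    then show ?case by (simp add: diag3_def mat_def vec_eq_iff forall_3)
  qed (simp add: diag3_mult)
  have "(\<lambda>n. (1 / fact n) *\<^sub>R diag3 (a ^ n) (b ^ n) (c ^ n)) sums diag3 (exp a) (exp b) (exp c)"
    unfolding sums_def
  proof (intro vec_tendstoI)
    fix i j :: 3
    have "(\<lambda>n. \<Sum>k<n. (1 / fact k) *\<^sub>R x ^ k) \<longlonglongrightarrow> exp x" for x :: complex
      using exp_converges[of x] by (simp add: sums_def divide_inverse)
    then show "(\<lambda>n. (\<Sum>k<n. (1 / fact k) *\<^sub>R diag3 (a ^ k) (b ^ k) (c ^ k)) $ i $ j)
        \<longlonglongrightarrow> diag3 (exp a) (exp b) (exp c) $ i $ j"
      using exhaust_3[of i] exhaust_3[of j] by (auto simp: diag3_def)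
  qed
  then show ?thesis
    unfolding matrix_exp_def pow by (rule sums_unique[symmetric])
qed

lemma matrix_inv_eqI:
  fixes A B :: "'a::comm_ring_1^'n^'n"
  assumes "A ** B = mat 1" "B ** A = mat 1"
  shows "matrix_inv A = B"
proof -
  have "A ** matrix_inv A = mat 1 \<and> matrix_inv A ** A = mat 1"
    unfolding matrix_inv_def by (rule someI[of _ B]) (use assms in blast)
  then show ?thesis
    using assms by (metis matrix_mul_assoc matrix_mul_lid matrix_mul_rid)
qed

lemma of_real_sqrt2_sq [simp]: "complex_of_real (sqrt 2) * complex_of_real (sqrt 2) = 2"
  by (simp flip: of_real_mult)

text \<open>The conjugate transpose of \<open>mat_U\<close>, hence its inverse.\<close>

definition mat_V :: "complex^3^3" where
  "mat_V = vector
     [vector [1 / of_real (sqrt 2), 0, - \<i> / of_real (sqrt 2)],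
      vector [0, 1, 0],
      vector [- \<i> / of_real (sqrt 2), 0, 1 / of_real (sqrt 2)]]"

lemma mat_U_V: "mat_U ** mat_V = mat 1" "mat_V ** mat_U = mat 1"
  by (simp_all add: mat_U_def mat_V_def mat_def vec_eq_iff forall_3 matrix_matrix_mult_def sum_3)

lemma matrix_inv_U: "matrix_inv mat_U = mat_V"
  by (rule matrix_inv_eqI) (rule mat_U_V)+

lemma mat_V_U_vec [simp]: "mat_V *v (mat_U *v z) = z"
  by (simp add: matrix_vector_mul_assoc mat_U_V)

lemma det_mat_U: "det mat_U = 1"
  by (simp add: mat_U_def det_3 power2_eq_square)

lemma herm_mat_U:
  "herm (mat_U *v z) (mat_U *v w) = - (cnj (z $ 1) * w $ 1) + cnj (z $ 2) * w $ 2 + cnj (z $ 3) * w $ 3"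
proof -
  \<comment> \<open>All that matters about 1 / sqrt 2 is that it is real and that
    \<open>2 * (x * x) = 1\<close>; naming it turns the claim into a polynomial identity.\<close>
  define x :: complex where "x = 1 / of_real (sqrt 2)"
  have x: "2 * (x * x) = 1" "cnj x = x"
    by (simp_all add: x_def)
  have U: "mat_U *v v = vector [x * (v $ 1 + \<i> * v $ 3), v $ 2, x * (\<i> * v $ 1 + v $ 3)]" for v
    by (simp add: mat_U_def x_def matrix_vector_mult_def sum_3 vec_eq_iff forall_3 field_simps)
  show ?thesis
    unfolding U herm_def mat_h_def
    apply (simp add: matrix_vector_mult_def sum_3 x(2))
    using x(1) i_squared apply algebra
    done
qed

lemma cnj_mult_self: "cnj z * z = of_real ((cmod z)\<^sup>2)"
  by (simp only: complex_norm_square mult.commute)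

lemma det3_mat_mult: "det3 (A *v a) (A *v b) (A *v c) = det A * det3 a b c"
proof -
  have "transpose (vector [A *v a, A *v b, A *v c] :: complex^3^3) = A ** transpose (vector [a, b, c])"
    by (simp add: vec_eq_iff forall_3 transpose_def matrix_vector_mult_def matrix_matrix_mult_def sum_3)
  then show ?thesis
    by (simp add: det3_def det_mul)
qed

text \<open>The block on coordinates 1 and 3 is \<open>u\<close> times a plane rotation by half of
  \<theta>1, with eigenvalues \<open>u\<close> times exp(i \<theta>1 / 2) and its conjugate. Merging
  the exponents gives phases that add up to zero.\<close>

lemma mat_R_eq:
  "mat_R \<theta>1 \<theta>2 = mat_U ** diag3 (exp (\<i> * of_real ((\<theta>1 - \<theta>2) / 3)))
     (exp (\<i> * of_real ((\<theta>1 + 2 * \<theta>2) / 3))) (exp (- (\<i> * of_real ((2 * \<theta>1 + \<theta>2) / 3)))) ** mat_V"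
proof -
  define u where "u = exp (- (\<i> / 6) * of_real (\<theta>1 + 2 * \<theta>2))"
  have 1: "exp (\<i> * of_real ((\<theta>1 - \<theta>2) / 3)) = u * (of_real (cos (\<theta>1 / 2)) + \<i> * of_real (sin (\<theta>1 / 2)))"
  proof -
    have "exp (\<i> * of_real ((\<theta>1 - \<theta>2) / 3)) = u * exp (\<i> * of_real (\<theta>1 / 2))"
      unfolding u_def exp_add[symmetric] by (rule arg_cong[of _ _ exp]) (simp add: field_simps)
    then show ?thesis by (simp only: exp_Euler cos_of_real sin_of_real)
  qed
  have 2: "exp (- (\<i> * of_real ((2 * \<theta>1 + \<theta>2) / 3))) = u * (of_real (cos (\<theta>1 / 2)) - \<i> * of_real (sin (\<theta>1 / 2)))"
  proof -
    have "exp (- (\<i> * of_real ((2 * \<theta>1 + \<theta>2) / 3))) = u * exp (- (\<i> * of_real (\<theta>1 / 2)))"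
      unfolding u_def exp_add[symmetric] by (rule arg_cong[of _ _ exp]) (simp add: field_simps)
    then show ?thesis by (simp only: exp_minus_Euler cos_of_real sin_of_real)
  qed
  define x :: complex where "x = 1 / of_real (sqrt 2)"
  have x: "2 * (x * x) = 1"
    by (simp add: x_def)
  have U: "mat_U = vector [vector [x, 0, \<i> * x], vector [0, 1, 0], vector [\<i> * x, 0, x]]"
    and V: "mat_V = vector [vector [x, 0, - \<i> * x], vector [0, 1, 0], vector [- \<i> * x, 0, x]]"
    by (simp_all add: mat_U_def mat_V_def x_def)
  show ?thesis
    unfolding mat_R_def Let_def 1 2 u_def[symmetric] U V
    apply (simp add: diag3_def vec_eq_iff forall_3 matrix_matrix_mult_def sum_3)
    using x i_squared apply (intro conjI; algebra)
    done
qed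

section \<open>Orbits of one-parameter groups\<close>

definition phase_vec :: "complex^3 \<Rightarrow> real^3 \<Rightarrow> real \<Rightarrow> complex^3" where
  "phase_vec b l t = (\<chi> j. b $ j * exp (- (\<i> * of_real (l $ j * t))))"

text \<open>The generator diag(-i \<open>l $ j\<close>) of the one-parameter group. Differentiating
  an orbit only replaces its initial vector by the image under this map, so every derivative is an
  orbit of the same group.\<close>

definition phase_deriv :: "real^3 \<Rightarrow> complex^3 \<Rightarrow> complex^3" where
  "phase_deriv l b = (\<chi> j. - \<i> * of_real (l $ j) * b $ j)"

lemma vderiv_phase_vec:
  "vderiv (\<lambda>t. A *v phase_vec b l t) = (\<lambda>t. A *v phase_vec (phase_deriv l b) l t)"
proof
  fix t
  have "(phase_vec b l has_vector_derivative phase_vec (phase_deriv l b) l t) (at t)"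
    unfolding phase_vec_def
  proof (rule has_vector_derivative_vec_lambda)
    fix j
    have "((\<lambda>z. b $ j * exp (- (\<i> * (of_real (l $ j) * z)))) has_field_derivative
        phase_deriv l b $ j * exp (- (\<i> * of_real (l $ j * t)))) (at (of_real t))"
      by (auto intro!: derivative_eq_intros simp: phase_deriv_def)
    then show "((\<lambda>t. b $ j * exp (- (\<i> * of_real (l $ j * t)))) has_vector_derivative
        phase_deriv l b $ j * exp (- (\<i> * of_real (l $ j * t)))) (at t)"
      using has_vector_derivative_real_field by fastforce
  qed
  then have "((\<lambda>t. A *v phase_vec b l t) has_vector_derivative A *v phase_vec (phase_deriv l b) l t) (at t)"
    by (rule bounded_linear.has_vector_derivative[OF matrix_vector_mul_bounded_linear])
  then show "vderiv (\<lambda>t. A *v phase_vec b l t) t = A *v phase_vec (phase_deriv l b) l t"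
    unfolding vderiv_def by (rule vector_derivative_at)
qed

lemma cnj_phase [simp]: "cnj (exp (- (\<i> * of_real x))) * exp (- (\<i> * of_real x)) = 1"
  by (simp add: exp_cnj flip: exp_add)

text \<open>In the diagonal form each coordinate meets only its own conjugate, so the phases, of
  modulus one, cancel.\<close>

lemma herm_phase_vec:
  "herm (mat_U *v phase_vec b l t) (mat_U *v phase_vec b' l t) = herm (mat_U *v b) (mat_U *v b')"
proof -
  have "cnj (phase_vec b l t $ j) * phase_vec b' l t $ j = cnj (b $ j) * b' $ j" for j
    using cnj_phase[of "l $ j * t"] unfolding phase_vec_def by (simp del: cnj_phase)
  then show ?thesis by (simp only: herm_mat_U)
qed

text \<open>All three vectors are multiplied by one diagonal matrix, whose determinant is 1 because
  the frequencies add up to zero.\<close>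

lemma det3_phase_vec:
  assumes "l $ 1 + l $ 2 + l $ 3 = 0"
  shows "det3 (phase_vec a l t) (phase_vec b l t) (phase_vec c l t) = det3 a b c"
proof -
  define E where "E j = exp (- (\<i> * of_real (l $ j * t)))" for j
  have "E 1 * E 2 * E 3 = exp (- (\<i> * of_real ((l $ 1 + l $ 2 + l $ 3) * t)))"
    unfolding E_def exp_add[symmetric] by (rule arg_cong[of _ _ exp]) (simp add: algebra_simps)
  then have E: "E 1 * E 2 * E 3 = 1"
    using assms by simp
  show ?thesis
    unfolding det3_def phase_vec_def E_def[symmetric]
    apply (simp add: det_3 transpose_def)
    using E by algebra
qed

text \<open>A Vandermonde determinant in the numbers -i \<open>l $ j\<close>, with
  \<open>b $ j\<close> pulled out of the rows; the factor \<open>\<i>\<close> is (-i)^3.\<close>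

lemma det3_phase_deriv:
  "det3 b (phase_deriv l b) (phase_deriv l (phase_deriv l b)) =
     \<i> * b $ 1 * b $ 2 * b $ 3 * of_real ((l $ 2 - l $ 1) * (l $ 3 - l $ 1) * (l $ 3 - l $ 2))"
proof -
  have "det3 b (\<chi> j. x j * b $ j) (\<chi> j. x j * (x j * b $ j)) =
      b $ 1 * b $ 2 * b $ 3 * ((x 2 - x 1) * (x 3 - x 1) * (x 3 - x 2))" for x :: "3 \<Rightarrow> complex"
    unfolding det3_def by (simp add: det_3 transpose_def algebra_simps)
  from this[of "\<lambda>j. - \<i> * of_real (l $ j)"] have
    "det3 b (phase_deriv l b) (phase_deriv l (phase_deriv l b)) = b $ 1 * b $ 2 * b $ 3 *
      ((- \<i> * of_real (l $ 2) - - \<i> * of_real (l $ 1)) * (- \<i> * of_real (l $ 3) - - \<i> * of_real (l $ 1)) *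
       (- \<i> * of_real (l $ 3) - - \<i> * of_real (l $ 2)))"
    by (simp add: phase_deriv_def)
  also have "(- \<i> * of_real (l $ 2) - - \<i> * of_real (l $ 1)) * (- \<i> * of_real (l $ 3) - - \<i> * of_real (l $ 1)) *
       (- \<i> * of_real (l $ 3) - - \<i> * of_real (l $ 2)) =
       (- \<i>) ^ 3 * ((of_real (l $ 2) - of_real (l $ 1)) * (of_real (l $ 3) - of_real (l $ 1)) *
         (of_real (l $ 3) - of_real (l $ 2)))"
    by (simp add: power3_eq_cube algebra_simps)
  finally show ?thesis
    by (simp add: power3_eq_cube)
qed

lemma mat_U_phase_vec_eq_0_iff: "mat_U *v phase_vec b l t = 0 \<longleftrightarrow> b = 0"
proof
  assume "mat_U *v phase_vec b l t = 0"
  then have "phase_vec b l t = 0"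
    using mat_V_U_vec by (metis matrix_vector_mult_0_right)
  then show "b = 0"
    by (simp add: phase_vec_def vec_eq_iff)
qed (simp add: phase_vec_def vec_eq_iff matrix_vector_mult_def)

text \<open>Products and determinants of the derivatives are constant along the orbit, so each
  condition is needed at time 0 only. A single lift witnesses all the existential definitions, and
  \<open>nat\<close> alone yields transversality, positivity and naturality.\<close>

lemma isoparametric_phase_orbit:
  assumes \<gamma>: "\<And>t. \<gamma> t = proj (mat_U *v phase_vec b l t)"
    and sum0: "l $ 1 + l $ 2 + l $ 3 = 0"
    and null: "herm (mat_U *v b) (mat_U *v b) = 0"
    and nat: "herm (mat_U *v b) (mat_U *v phase_deriv l b) = \<i>"
    and det: "det3 b (phase_deriv l b) (phase_deriv l (phase_deriv l b)) = -1"
    and \<kappa>: "herm (mat_U *v phase_deriv l b) (mat_U *v phase_deriv l b) = of_real (2 * \<kappa>)"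
    and \<tau>: "Im (herm (mat_U *v phase_deriv l (phase_deriv l b)) (mat_U *v phase_deriv l b)) = \<tau> - 3 * \<kappa>\<^sup>2"
  shows "isoparametric \<gamma> \<kappa> \<tau>"
proof -
  define \<Gamma> where "\<Gamma> t = mat_U *v phase_vec b l t" for t
  have \<Gamma>1: "vderiv \<Gamma> = (\<lambda>t. mat_U *v phase_vec (phase_deriv l b) l t)"
    unfolding \<Gamma>_def by (rule vderiv_phase_vec)
  have \<Gamma>2: "vderiv (vderiv \<Gamma>) = (\<lambda>t. mat_U *v phase_vec (phase_deriv l (phase_deriv l b)) l t)"
    unfolding \<Gamma>1 by (rule vderiv_phase_vec)
  have "b \<noteq> 0"
    using nat by (auto simp: herm_def)
  then have nul: "\<Gamma> t \<in> null_vectors" for t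
    using null by (simp add: null_vectors_def \<Gamma>_def herm_phase_vec mat_U_phase_vec_eq_0_iff)
  \<comment> \<open>The coordinates of the lift, extended to complex time as entire
    functions.\<close>
  define F where "F i z = (\<Sum>j\<in>UNIV. mat_U $ i $ j * (b $ j * exp (- (\<i> * (of_real (l $ j) * z)))))" for i :: 3 and z
  have "F i holomorphic_on UNIV" for i
    unfolding F_def by (intro holomorphic_intros)
  moreover have "\<Gamma> t = (\<chi> i. F i (of_real t))" for t
    by (simp add: \<Gamma>_def F_def matrix_vector_mult_def phase_vec_def vec_eq_iff)
  ultimately have smooth: "is_lift \<Gamma> \<gamma>" "smooth_curve_in_sphere \<gamma>"
    using smooth_curve_in_sphere_holomorphic[of F \<Gamma> \<gamma>] nul \<gamma> by (simp_all add: \<Gamma>_def)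
  have h: "herm (\<Gamma> t) (vderiv \<Gamma> t) = \<i>" for t
    unfolding \<Gamma>1 by (simp add: \<Gamma>_def herm_phase_vec nat)
  have d: "det3 (\<Gamma> t) (vderiv \<Gamma> t) (vderiv (vderiv \<Gamma>) t) = -1" for t
    unfolding \<Gamma>2 by (simp add: \<Gamma>1 \<Gamma>_def det3_mat_mult det_mat_U det3_phase_vec[OF sum0] det)
  \<comment> \<open>The denominator of the contact form must not vanish: division by zero would give
    the value 0.\<close>
  have "(\<Sum>i\<in>UNIV. cnj (\<Gamma> t $ i) * \<Gamma> t $ i) \<noteq> 0" for t
  proof -
    have "(\<Sum>i\<in>UNIV. cnj (\<Gamma> t $ i) * \<Gamma> t $ i) = of_real (\<Sum>i\<in>UNIV. (cmod (\<Gamma> t $ i))\<^sup>2)"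
      by (simp only: cnj_mult_self of_real_sum)
    also have "\<dots> \<noteq> 0"
      using nul[of t] unfolding of_real_eq_0_iff
      by (subst sum_nonneg_eq_0_iff) (auto simp: null_vectors_def vec_eq_iff)
    finally show ?thesis .
  qed
  then have "contact_form (\<Gamma> t) (vderiv \<Gamma> t) \<noteq> 0" for t
    by (simp add: contact_form_def h)
  then have "transversal \<gamma>"
    using smooth by (auto simp: transversal_def)
  moreover have "positively_parametrized \<gamma>"
    unfolding positively_parametrized_def using smooth h by (intro exI[of _ \<Gamma>]) simp
  moreover have "generic \<gamma>"
    unfolding generic_def using smooth d by (intro exI[of _ \<Gamma>]) simp
  moreover have "natural_with_bending_twist \<gamma> (\<lambda>_. \<kappa>) (\<lambda>_. \<tau>)"
    unfolding natural_with_bending_twist_def wilczynski_lift_def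
  proof (intro exI[of _ \<Gamma>] conjI allI)
    show "of_real \<kappa> = 1 / 2 * herm (vderiv \<Gamma> t) (vderiv \<Gamma> t)" for t
      unfolding \<Gamma>1 herm_phase_vec \<kappa> by simp
    show "\<tau> = Im (herm (vderiv (vderiv \<Gamma>) t) (vderiv \<Gamma> t)) + 3 * \<kappa>\<^sup>2" for t
      unfolding \<Gamma>2 unfolding \<Gamma>1 herm_phase_vec \<tau> by simp
  qed (simp_all add: smooth d h)
  ultimately show ?thesis
    unfolding isoparametric_def by blast
qed

section \<open>Periods\<close>

text \<open>Two points of the orbit agree exactly when all three phases advance by the same factor
  between the two times. Dividing by the first phase leaves two congruences modulo 2 pi for the
  frequency differences.\<close>

lemma proj_phase_vec_eq_iff:
  assumes b: "\<And>j. b $ j \<noteq> 0"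
  shows "proj (mat_U *v phase_vec b l s) = proj (mat_U *v phase_vec b l t) \<longleftrightarrow>
    (\<exists>m n :: int. (l $ 2 - l $ 1) * (s - t) = of_int m * (2 * pi) \<and> (l $ 3 - l $ 1) * (s - t) = of_int n * (2 * pi))"
    (is "?L \<longleftrightarrow> ?R")
proof
  assume ?L
  then obtain c where "mat_U *v phase_vec b l s = c *s (mat_U *v phase_vec b l t)"
    by (rule proj_eqD)
  then have "phase_vec b l s = c *s phase_vec b l t"
    by (metis mat_V_U_vec vector_scalar_commute)
  then have c: "exp (- (\<i> * of_real (l $ j * s))) = c * exp (- (\<i> * of_real (l $ j * t)))" for j
    using b[of j] by (auto simp: phase_vec_def vec_eq_iff dest: spec[of _ j])
  have "c = exp (\<i> * of_real (- (l $ j * (s - t))))" for j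
  proof -
    have "exp (\<i> * of_real (- (l $ j * (s - t)))) * exp (- (\<i> * of_real (l $ j * t))) = exp (- (\<i> * of_real (l $ j * s)))"
      unfolding exp_add[symmetric] by (rule arg_cong[of _ _ exp]) (simp add: algebra_simps)
    then show ?thesis unfolding c by simp
  qed
  then have "exp (\<i> * of_real (- (l $ 1 * (s - t)))) = exp (\<i> * of_real (- (l $ j * (s - t))))" for j
    by metis
  then have "\<exists>n::int. (l $ j - l $ 1) * (s - t) = of_int n * (2 * pi)" for j
    unfolding exp_eq[of "\<i> * of_real (- (l $ 1 * (s - t)))"]
    by (auto simp: complex_eq_iff algebra_simps)
  then show ?R by blast
next
  assume ?R
  \<comment> \<open>The case \<open>j = 1\<close> is included, with \<open>n = 0\<close>.\<close>
  then have n: "\<exists>n::int. (l $ j - l $ 1) * (s - t) = of_int n * (2 * pi)" for j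
    using exhaust_3[of j] by (auto intro: exI[of _ 0])
  define c where "c = exp (\<i> * of_real (- (l $ 1 * (s - t))))"
  have "exp (- (\<i> * of_real (l $ j * s))) = c * exp (- (\<i> * of_real (l $ j * t)))" for j
  proof -
    obtain n :: int where n: "(l $ j - l $ 1) * (s - t) = of_int n * (2 * pi)"
      using n by blast
    then have n: "l $ j * s = l $ 1 * (s - t) + l $ j * t + of_int n * (2 * pi)"
      by (simp add: algebra_simps)
    then show ?thesis
      unfolding c_def exp_add[symmetric] exp_eq n
      by (intro exI[of _ "-n"]) (simp add: algebra_simps)
  qed
  then have "phase_vec b l s = c *s phase_vec b l t"
    by (simp add: phase_vec_def vec_eq_iff)
  then show ?L
    using proj_smult[of c] by (simp add: vector_scalar_commute c_def)
qed

text \<open>If the fibres are exactly the cosets of the integer multiples of \<omega>, every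
  positive period is such a multiple, and no fibre meets a half-open interval of length \<omega>
  twice.\<close>

lemma minimal_period_injI:
  fixes f :: "real \<Rightarrow> 'a"
  assumes "\<omega> > 0" and f: "\<And>s t. f s = f t \<longleftrightarrow> (\<exists>k::int. s - t = of_int k * \<omega>)"
  shows "minimal_period f \<omega>" "inj_on f {0..<\<omega>}"
proof -
  have "\<omega> \<le> \<omega>'" if "0 < \<omega>'" "f (0 + \<omega>') = f 0" for \<omega>'
  proof -
    from that(2) obtain k :: int where k: "\<omega>' = of_int k * \<omega>"
      unfolding f by auto
    with that(1) assms(1) have "k \<ge> 1"
      by (simp add: zero_less_mult_iff)
    then show ?thesis
      using k assms(1) mult_right_mono[of 1 "real_of_int k" \<omega>] by simp
  qed
  moreover have "f (s + \<omega>) = f s" for s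
    unfolding f by (rule exI[of _ 1]) simp
  ultimately show "minimal_period f \<omega>"
    using assms(1) unfolding minimal_period_def by blast
  show "inj_on f {0..<\<omega>}"
  proof (rule inj_onI)
    fix s t assume st: "s \<in> {0..<\<omega>}" "t \<in> {0..<\<omega>}" "f s = f t"
    then obtain k :: int where k: "s - t = of_int k * \<omega>"
      unfolding f by blast
    with st have "\<bar>of_int k * \<omega>\<bar> < 1 * \<omega>"
      by auto
    then have "\<bar>k\<bar> < 1"
      using assms(1) by (simp add: abs_mult)
    with k show "s = t" by simp
  qed
qed

text \<open>By Bezout, \<open>p x\<close> and \<open>q x\<close> both lie in 2 pi Z only if
  \<open>x\<close> does, so the minimal period is 2 pi / \<open>g\<close>.\<close>

lemma simple_closed_phase_orbit:
  fixes p q :: int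
  assumes \<gamma>: "\<And>t. \<gamma> t = proj (mat_U *v phase_vec b l t)"
    and b: "\<And>j. b $ j \<noteq> 0" and g: "g > 0" and pq: "coprime p q"
    and l: "l $ 2 - l $ 1 = of_int p * g" "l $ 3 - l $ 1 = of_int q * g"
  shows "simple_closed \<gamma>"
proof -
  have "\<gamma> s = \<gamma> t \<longleftrightarrow> (\<exists>k::int. s - t = of_int k * (2 * pi / g))" for s t
  proof -
    have "(\<exists>m n :: int. of_int p * g * (s - t) = of_int m * (2 * pi) \<and> of_int q * g * (s - t) = of_int n * (2 * pi))
      \<longleftrightarrow> (\<exists>k::int. s - t = of_int k * (2 * pi / g))"
    proof safe
      fix m n :: int
      assume mn: "of_int p * g * (s - t) = of_int m * (2 * pi)" "of_int q * g * (s - t) = of_int n * (2 * pi)"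
      obtain u v where "u * p + v * q = 1"
        using pq bezout_int[of p q] by (auto simp: coprime_iff_gcd_eq_1)
      then have "of_int u * of_int p + of_int v * of_int q = (1::real)"
        by (metis of_int_1 of_int_add of_int_mult)
      then have "g * (s - t) = of_int u * (of_int p * g * (s - t)) + of_int v * (of_int q * g * (s - t))"
        by algebra
      also have "\<dots> = of_int (u * m + v * n) * (2 * pi)"
        unfolding mn by (simp add: algebra_simps)
      finally show "\<exists>k::int. s - t = of_int k * (2 * pi / g)"
        using g by (intro exI[of _ "u * m + v * n"]) (simp add: field_simps)
    next
      fix k :: int
      assume "s - t = of_int k * (2 * pi / g)"
      then show "\<exists>m n :: int. of_int p * g * (s - t) = of_int m * (2 * pi) \<and> of_int q * g * (s - t) = of_int n * (2 * pi)"
        using g by (intro exI[of _ "p * k"] exI[of _ "q * k"]) simp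
    qed
    then show ?thesis
      unfolding \<gamma> proj_phase_vec_eq_iff[OF b] l by simp
  qed
  from minimal_period_injI[OF _ this] g show ?thesis
    unfolding simple_closed_def by (metis divide_pos_pos mult_pos_pos pi_gt_zero zero_less_numeral)
qed

section \<open>Bending, twist and eigenvalues\<close>

text \<open>The second and third rows express an eigenvector through its second coordinate, which
  therefore cannot vanish; the first row then becomes the characteristic equation.\<close>

lemma eigenvalues_mat_H:
  "eigenvalues (mat_H \<kappa> \<tau>) =
     {e. e ^ 3 + of_real (\<tau> - 3 * \<kappa>\<^sup>2) * e + of_real (1 - 2 * \<kappa> ^ 3 - 2 * \<kappa> * \<tau>) = 0}"
proof -
  have H: "mat_H \<kappa> \<tau> *v v = e *s v \<longleftrightarrow>
      - of_real \<kappa> * v $ 1 + v $ 2 + \<i> * of_real \<tau> * v $ 3 = e * v $ 1 \<and>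
      2 * of_real \<kappa> * v $ 2 + \<i> * v $ 3 = e * v $ 2 \<and>
      \<i> * v $ 1 - of_real \<kappa> * v $ 3 = e * v $ 3" for v e
  proof -
    have i: "\<i> * (2 * \<i> * x) = - 2 * x" for x
      by simp
    show ?thesis
      by (simp add: i mat_H_def vec_eq_iff forall_3 matrix_vector_mult_def sum_3)
  qed
  have "e ^ 3 + of_real (\<tau> - 3 * \<kappa>\<^sup>2) * e + of_real (1 - 2 * \<kappa> ^ 3 - 2 * \<kappa> * \<tau>) = 0"
    if "v \<noteq> 0" "mat_H \<kappa> \<tau> *v v = e *s v" for v e
  proof -
    have v3: "v $ 3 = - \<i> * (e - 2 * of_real \<kappa>) * v $ 2"
      using that(2) i_squared unfolding H by algebra
    have v1: "v $ 1 = - (e + of_real \<kappa>) * (e - 2 * of_real \<kappa>) * v $ 2"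
      using that(2) i_squared v3 unfolding H by algebra
    have "v $ 2 \<noteq> 0"
      using that(1) v1 v3 by (auto simp: vec_eq_iff forall_3)
    moreover have "v $ 2 * (e ^ 3 + (of_real \<tau> - 3 * (of_real \<kappa>)\<^sup>2) * e + (1 - 2 * of_real \<kappa> ^ 3 - 2 * of_real \<kappa> * of_real \<tau>)) = 0"
      using that(2) i_squared v1 v3 unfolding H by algebra
    ultimately show ?thesis by simp
  qed
  moreover have "\<exists>v. v \<noteq> 0 \<and> mat_H \<kappa> \<tau> *v v = e *s v"
    if "e ^ 3 + of_real (\<tau> - 3 * \<kappa>\<^sup>2) * e + of_real (1 - 2 * \<kappa> ^ 3 - 2 * \<kappa> * \<tau>) = 0" for e
  proof -
    define v :: "complex^3" where
      "v = vector [- (e + of_real \<kappa>) * (e - 2 * of_real \<kappa>), 1, - \<i> * (e - 2 * of_real \<kappa>)]"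
    have "e ^ 3 + (of_real \<tau> - 3 * (of_real \<kappa>)\<^sup>2) * e + (1 - 2 * of_real \<kappa> ^ 3 - 2 * of_real \<kappa> * of_real \<tau>) = 0"
      using that by simp
    then have "mat_H \<kappa> \<tau> *v v = e *s v"
      unfolding H v_def vector_3 by (simp add: power3_eq_cube power2_eq_square algebra_simps)
    moreover have "v \<noteq> 0"
      by (auto simp: v_def vec_eq_iff forall_3)
    ultimately show ?thesis by blast
  qed
  ultimately show ?thesis
    unfolding eigenvalues_def by blast
qed

text \<open>The bending and the twist are moments of the measure with masses \<open>n\<^sub>j\<close> at the points \<open>x\<^sub>j\<close>; the last
  hypothesis fixes the determinant of its Hankel matrix, which determines the fourth moment and
  hence the constant coefficient of the polynomial with roots \<open>x\<^sub>j\<close>.\<close>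

lemma moments_char_poly:
  fixes x1 x2 x3 n1 n2 n3 \<kappa> \<tau> :: real
  assumes "x1 + x2 + x3 = 0" and "n1 + n2 + n3 = 0"
    and "n1 * x1 + n2 * x2 + n3 * x3 = -1"
    and "n1 * x1\<^sup>2 + n2 * x2\<^sup>2 + n3 * x3\<^sup>2 = 2 * \<kappa>"
    and "n1 * x1 ^ 3 + n2 * x2 ^ 3 + n3 * x3 ^ 3 = \<tau> - 3 * \<kappa>\<^sup>2"
    and hankel: "n1 * n2 * n3 * ((x2 - x1) * (x3 - x1) * (x3 - x2))\<^sup>2 = -1"
  shows "\<tau> - 3 * \<kappa>\<^sup>2 = x1 * x2 + x1 * x3 + x2 * x3"
    and "1 - 2 * \<kappa> ^ 3 - 2 * \<kappa> * \<tau> = - (x1 * x2 * x3)"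
proof -
  define a b where "a = x1 * x2 + x1 * x3 + x2 * x3" and "b = - (x1 * x2 * x3)"
  have x3: "x3 = - x1 - x2"
    using assms(1) by simp
  \<comment> \<open>Each \<open>x\<close>-value is a root of x^3 + a x + b, so the third and fourth
    moments follow from the lower ones by recurrence.\<close>
  have cube: "x1 ^ 3 = - a * x1 - b" "x2 ^ 3 = - a * x2 - b" "x3 ^ 3 = - a * x3 - b"
    by (simp_all add: a_def b_def x3 power3_eq_cube algebra_simps)
  have fourth: "x1 ^ 4 = - a * x1\<^sup>2 - b * x1" "x2 ^ 4 = - a * x2\<^sup>2 - b * x2" "x3 ^ 4 = - a * x3\<^sup>2 - b * x3"
    using cube by algebra+
  have m3: "n1 * x1 ^ 3 + n2 * x2 ^ 3 + n3 * x3 ^ 3 = a"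
    unfolding cube using assms(2,3) by algebra
  with assms(5) show a: "\<tau> - 3 * \<kappa>\<^sup>2 = x1 * x2 + x1 * x3 + x2 * x3"
    by (simp add: a_def)
  have m4: "n1 * x1 ^ 4 + n2 * x2 ^ 4 + n3 * x3 ^ 4 = - 2 * a * \<kappa> + b"
    unfolding fourth using assms(3,4) by algebra
  \<comment> \<open>The Hankel matrix of the moments factors as V diag(n1, n2, n3) V^T with V the
    Vandermonde matrix; this compares determinants.\<close>
  have hankel_det: "m0 * (m2 * m4 - m3\<^sup>2) - m1 * (m1 * m4 - m2 * m3) + m2 * (m1 * m3 - m2\<^sup>2) =
      n1 * n2 * n3 * ((x2 - x1) * (x3 - x1) * (x3 - x2))\<^sup>2"
    if "m0 = n1 + n2 + n3" "m1 = n1 * x1 + n2 * x2 + n3 * x3" "m2 = n1 * x1\<^sup>2 + n2 * x2\<^sup>2 + n3 * x3\<^sup>2"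
      "m3 = n1 * x1 ^ 3 + n2 * x2 ^ 3 + n3 * x3 ^ 3" "m4 = n1 * x1 ^ 4 + n2 * x2 ^ 4 + n3 * x3 ^ 4"
    for m0 m1 m2 m3 m4
    unfolding that by (simp add: power4_eq_xxxx power3_eq_cube power2_eq_square algebra_simps)
  from hankel_det[OF refl refl refl refl refl]
  have "b = 1 - 2 * a * \<kappa> - 8 * \<kappa> ^ 3"
    unfolding assms(2-4) m3 m4 hankel by (simp add: power3_eq_cube power2_eq_square algebra_simps)
  moreover have "\<tau> = a + 3 * \<kappa>\<^sup>2"
    using a by (simp add: a_def)
  ultimately show "1 - 2 * \<kappa> ^ 3 - 2 * \<kappa> * \<tau> = - (x1 * x2 * x3)"
    unfolding b_def[symmetric] by (simp add: power3_eq_cube power2_eq_square algebra_simps)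
qed

text \<open>The products of successive derivatives of the lift are, up to powers of
  \<open>\<i>\<close>, the moments of signed masses at the frequencies. The first mass is negative
  because of the signature of the form.\<close>

lemma phase_orbit_moments:
  fixes \<kappa> \<tau> :: real and b :: "complex^3" and l :: "real^3"
  defines "n1 \<equiv> - (cmod (b $ 1))\<^sup>2" and "n2 \<equiv> (cmod (b $ 2))\<^sup>2" and "n3 \<equiv> (cmod (b $ 3))\<^sup>2"
  assumes \<gamma>: "\<And>t. \<gamma> t = proj (mat_U *v phase_vec b l t)"
    and sum0: "l $ 1 + l $ 2 + l $ 3 = 0"
    and m0: "n1 + n2 + n3 = 0"
    and m1: "n1 * l $ 1 + n2 * l $ 2 + n3 * l $ 3 = -1"
    and det: "\<i> * b $ 1 * b $ 2 * b $ 3 * of_real ((l $ 2 - l $ 1) * (l $ 3 - l $ 1) * (l $ 3 - l $ 2)) = -1"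
    and \<kappa>: "n1 * (l $ 1)\<^sup>2 + n2 * (l $ 2)\<^sup>2 + n3 * (l $ 3)\<^sup>2 = 2 * \<kappa>"
    and \<tau>: "\<tau> = l $ 1 * l $ 2 + l $ 1 * l $ 3 + l $ 2 * l $ 3 + 3 * \<kappa>\<^sup>2"
  shows "isoparametric \<gamma> \<kappa> \<tau>"
    and "eigenvalues (mat_H \<kappa> \<tau>) = {of_real (l $ 1), of_real (l $ 2), of_real (l $ 3)}"
proof -
  have n: "cnj (b $ 1) * b $ 1 = - of_real n1" "cnj (b $ 2) * b $ 2 = of_real n2" "cnj (b $ 3) * b $ 3 = of_real n3"
    by (simp_all only: n1_def n2_def n3_def cnj_mult_self of_real_minus minus_minus)
  have l3: "l $ 3 = - l $ 1 - l $ 2"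
    using sum0 by simp
  \<comment> \<open>The frequencies solve a cubic x^3 + a x + b = 0, so the moments 0 and -1 of
    orders zero and one force the third moment to be a.\<close>
  have m3: "n1 * l $ 1 ^ 3 + n2 * l $ 2 ^ 3 + n3 * l $ 3 ^ 3 = \<tau> - 3 * \<kappa>\<^sup>2"
    using m0 m1 sum0 \<tau> by algebra
  \<comment> \<open>The squared modulus of the Wilczynski condition is the Hankel condition, with
    the sign supplied by \<open>n1\<close>.\<close>
  have "cmod (b $ 1) * cmod (b $ 2) * cmod (b $ 3) * \<bar>(l $ 2 - l $ 1) * (l $ 3 - l $ 1) * (l $ 3 - l $ 2)\<bar> = 1"
    using arg_cong[OF det, of cmod] by (simp only: norm_mult norm_ii norm_of_real norm_minus_cancel norm_one mult_1)
  from arg_cong[OF this, of "\<lambda>x. x\<^sup>2"]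
  have "n1 * n2 * n3 * ((l $ 2 - l $ 1) * (l $ 3 - l $ 1) * (l $ 3 - l $ 2))\<^sup>2 = -1"
    by (simp only: n1_def n2_def n3_def power_mult_distrib power2_abs) simp
  note coeffs = moments_char_poly[OF sum0 m0 m1 \<kappa> m3 this]
  show "eigenvalues (mat_H \<kappa> \<tau>) = {of_real (l $ 1), of_real (l $ 2), of_real (l $ 3)}"
  proof -
    have "e ^ 3 + of_real (\<tau> - 3 * \<kappa>\<^sup>2) * e + of_real (1 - 2 * \<kappa> ^ 3 - 2 * \<kappa> * \<tau>) =
        (e - of_real (l $ 1)) * (e - of_real (l $ 2)) * (e - of_real (l $ 3))" for e :: complex
      unfolding coeffs l3 by (simp add: power3_eq_cube algebra_simps)
    then show ?thesis
      unfolding eigenvalues_mat_H by auto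
  qed
  have herm: "herm (mat_U *v (\<chi> j. x j * b $ j)) (mat_U *v (\<chi> j. y j * b $ j)) =
      cnj (x 1) * y 1 * of_real n1 + cnj (x 2) * y 2 * of_real n2 + cnj (x 3) * y 3 * of_real n3" for x y
  proof -
    have "cnj (x j * b $ j) * (y j * b $ j) = cnj (x j) * y j * (cnj (b $ j) * b $ j)" for j
      by simp
    then show ?thesis
      by (simp only: herm_mat_U vec_lambda_beta n) simp
  qed
  define d where "d j = - \<i> * of_real (l $ j)" for j
  have d: "phase_deriv l b = (\<chi> j. d j * b $ j)"
    "phase_deriv l (\<chi> j. d j * b $ j) = (\<chi> j. d j * d j * b $ j)"
    by (simp_all add: phase_deriv_def d_def mult.assoc)
  have h: "herm (mat_U *v b) (mat_U *v b) = of_real (n1 + n2 + n3)"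
    "herm (mat_U *v b) (mat_U *v phase_deriv l b) = - \<i> * of_real (n1 * l $ 1 + n2 * l $ 2 + n3 * l $ 3)"
    "herm (mat_U *v phase_deriv l b) (mat_U *v phase_deriv l b) =
      of_real (n1 * (l $ 1)\<^sup>2 + n2 * (l $ 2)\<^sup>2 + n3 * (l $ 3)\<^sup>2)"
    "herm (mat_U *v phase_deriv l (phase_deriv l b)) (mat_U *v phase_deriv l b) =
      \<i> * of_real (n1 * l $ 1 ^ 3 + n2 * l $ 2 ^ 3 + n3 * l $ 3 ^ 3)"
    using herm[of "\<lambda>_. 1" "\<lambda>_. 1"] herm[of "\<lambda>_. 1" d] herm[of d d] herm[of "\<lambda>j. d j * d j" d]
    by (simp_all add: d power2_eq_square power3_eq_cube) (simp_all add: d_def algebra_simps)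
  show "isoparametric \<gamma> \<kappa> \<tau>"
    by (rule isoparametric_phase_orbit[OF \<gamma> sum0]) (simp_all only: h m0 m1 m3 \<kappa> det3_phase_deriv det, simp_all)
qed

section \<open>The parameter domain\<close>

text \<open>The first expression is a concave quadratic in \<rho>^2, and the bound in
  \<open>frakA\<close> keeps \<rho>^2 below its smaller root. The second one is a product of linear
  factors in r and of \<rho> (\<rho>^4 - 4), both of them negative.\<close>

lemma frakA_signs:
  assumes "(r, \<rho>) \<in> frakA"
  shows "4 + 8 * r + 12 * \<rho>^2 + (1 + 2 * r) * \<rho>^4 < 0"
    and "(2 + 3 * r - 3 * r^2 - 2 * r^3) * (- 4 * \<rho> + \<rho>^5) > 0"
proof -
  have r: "-2 < r" "r < -1/2" and \<rho>: "0 < \<rho>" "\<rho> < sqrt 2"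
    and \<rho>': "\<rho> < sqrt (2 * (-3 + 2 * sqrt (2 - r - r\<^sup>2)) / (1 + 2 * r))"
    using assms by (auto simp: frakA_def)
  have sq: "\<rho>\<^sup>2 < x" if "\<rho> < sqrt x" for x
    using that \<rho>(1) real_le_lsqrt[of \<rho> x] by linarith
  define k where "k = - (1 + 2 * r)"
  define w where "w = sqrt (2 - r - r\<^sup>2)"
  have k: "0 < k"
    using r by (simp add: k_def)
  have "0 \<le> (1 - r) * (2 + r)"
    using r by simp
  then have w: "w\<^sup>2 = 2 - r - r\<^sup>2" "0 \<le> w"
    by (simp_all add: w_def power2_eq_square algebra_simps)
  have "\<rho>\<^sup>2 < 2 * (-3 + 2 * w) / (1 + 2 * r)"
    unfolding w_def by (rule sq) (rule \<rho>')
  then have "k * \<rho>\<^sup>2 < 6 - 4 * w"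
    using k by (simp add: k_def field_simps)
  then have "(4 * w)\<^sup>2 < (6 - k * \<rho>\<^sup>2)\<^sup>2"
    using w by (intro power_strict_mono) auto
  \<comment> \<open>Completing the square: the left-hand side equals (4 w)^2 - (6 - k
    \<rho>^2)^2.\<close>
  then have "k * (4 + 8 * r + 12 * \<rho>^2 + (1 + 2 * r) * \<rho>^4) < 0"
    using w(1) by (simp add: k_def power2_eq_square power4_eq_xxxx algebra_simps)
  with k show "4 + 8 * r + 12 * \<rho>^2 + (1 + 2 * r) * \<rho>^4 < 0"
    by (simp add: mult_less_0_iff)
  have "\<rho>\<^sup>2 < 2"
    by (rule sq) (rule \<rho>)
  then have "(2 - \<rho>\<^sup>2) * (2 + \<rho>\<^sup>2) > 0"
    by (simp add: add_pos_nonneg)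
  then have "((1 - r) * (2 + r) * k) * (\<rho> * ((2 - \<rho>\<^sup>2) * (2 + \<rho>\<^sup>2))) > 0"
    using r \<rho> k by simp
  also have "((1 - r) * (2 + r) * k) * (\<rho> * ((2 - \<rho>\<^sup>2) * (2 + \<rho>\<^sup>2))) =
      (2 + 3 * r - 3 * r^2 - 2 * r^3) * (- 4 * \<rho> + \<rho>^5)"
    by (simp add: k_def power2_eq_square power3_eq_cube eval_nat_numeral algebra_simps)
  finally show "(2 + 3 * r - 3 * r^2 - 2 * r^3) * (- 4 * \<rho> + \<rho>^5) > 0" .
qed

text \<open>Everything rests on \<open>M < 2 * \<kappa>\<close>. Since 0 \<le> 1 + r + r^2 \<le> 3,
  the subtracted term lies between 0 and 3 M^2, which is less than 12 \<kappa>^2, and both bounds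
  for the absolute value follow.\<close>

lemma first_class_inequality:
  fixes r \<rho> M \<kappa> :: real
  assumes r: "-2 < r" "r < -1/2" and \<rho>: "0 < \<rho>" and M: "0 < M"
    and P: "4 + 8 * r + 12 * \<rho>^2 + (1 + 2 * r) * \<rho>^4 < 0"
    and \<kappa>: "2 * \<kappa> * (4 + 8 * r + 12 * \<rho>^2 + (1 + 2 * r) * \<rho>^4) =
      - (M * (\<rho>\<^sup>2 * (4 - 8 * r - 8 * r\<^sup>2) - (1 + 2 * r) * (4 + \<rho>^4)))"
  shows "3 * \<kappa> > sqrt \<bar>3 * \<kappa>\<^sup>2 - M\<^sup>2 * (1 + r + r\<^sup>2)\<bar>"
proof -
  define K where "K = - (4 + 8 * r + 12 * \<rho>^2 + (1 + 2 * r) * \<rho>^4)"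
  define N where "N = \<rho>\<^sup>2 * (4 - 8 * r - 8 * r\<^sup>2) - (1 + 2 * r) * (4 + \<rho>^4)"
  have K: "K > 0"
    using P by (simp add: K_def)
  have "N - K = \<rho>\<^sup>2 * (8 * (1 - r) * (2 + r))"
    by (simp add: N_def K_def power2_eq_square algebra_simps)
  also have "\<dots> > 0"
    using r \<rho> by simp
  finally have NK: "N > K"
    by simp
  have \<kappa>K: "2 * \<kappa> * K = M * N"
    using \<kappa> by (simp add: N_def K_def algebra_simps)
  with K NK M have "M * K < 2 * \<kappa> * K"
    by simp
  with K have M\<kappa>: "M < 2 * \<kappa>"
    by simp
  have "M\<^sup>2 * (1 + r + r\<^sup>2) \<le> M\<^sup>2 * 3"
  proof -
    have "0 < (1 - r) * (2 + r)"
      using r by simp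
    then show ?thesis
      by (intro mult_left_mono) (simp_all add: power2_eq_square algebra_simps)
  qed
  moreover have "M\<^sup>2 < (2 * \<kappa>)\<^sup>2"
    using M M\<kappa> by (intro power_strict_mono) auto
  moreover have "0 \<le> M\<^sup>2 * (1 + r + r\<^sup>2)"
  proof -
    have "0 \<le> (2 * r + 1)\<^sup>2 + 3"
      by (rule add_nonneg_nonneg) auto
    then show ?thesis
      by (intro mult_nonneg_nonneg) (simp_all add: power2_eq_square algebra_simps)
  qed
  moreover have "0 < \<kappa>\<^sup>2"
    using M M\<kappa> by simp
  ultimately have "\<bar>3 * \<kappa>\<^sup>2 - M\<^sup>2 * (1 + r + r\<^sup>2)\<bar> < (3 * \<kappa>)\<^sup>2"
    by (simp add: power_mult_distrib abs_less_iff)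
  then show ?thesis
    using M M\<kappa> by (intro real_less_lsqrt) auto
qed

section \<open>Symmetrical configurations\<close>

lemma scaleR_mat_D1:
  "s *\<^sub>R mat_D1 r \<rho> = diag3 (- (\<i> * of_real (e12 r \<rho> * s))) (- (\<i> * of_real (e13 r \<rho> * s)))
    (- (\<i> * of_real (e11 r \<rho> * s)))"
  unfolding mat_D1_def diag3_def vec_eq_iff forall_3
  by simp (simp add: scaleR_conv_of_real)

text \<open>The free scalar \<open>c\<close> leaves room to normalize the lift.\<close>

lemma symm_config1_eq_phase_orbit:
  assumes "c \<noteq> 0"
  shows "symm_config1 r \<rho> s = proj (mat_U *v
    phase_vec (c *s (mat_V *v vector [1, of_real \<rho>, \<i> * of_real (\<rho>\<^sup>2) / 2]))
      (vector [e12 r \<rho>, e13 r \<rho>, e11 r \<rho>]) s)"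
proof -
  define w :: "complex^3" where "w = mat_V *v vector [1, of_real \<rho>, \<i> * of_real (\<rho>\<^sup>2) / 2]"
  define l :: "real^3" where "l = vector [e12 r \<rho>, e13 r \<rho>, e11 r \<rho>]"
  have D: "s *\<^sub>R mat_D1 r \<rho> = diag3 (- (\<i> * of_real (l $ 1 * s))) (- (\<i> * of_real (l $ 2 * s))) (- (\<i> * of_real (l $ 3 * s)))"
    by (simp add: scaleR_mat_D1 l_def)
  have "matrix_exp (s *\<^sub>R mat_D1 r \<rho>) *v w = phase_vec w l s"
    unfolding D matrix_exp_diag3 diag3_mult_vec by (simp add: phase_vec_def vec_eq_iff forall_3)
  then have "symm_config1 r \<rho> s = proj (mat_U *v phase_vec w l s)"
    by (simp add: symm_config1_def pt_S_def act_proj matrix_inv_U w_def flip: matrix_vector_mul_assoc)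
  also have "\<dots> = proj (c *s (mat_U *v phase_vec w l s))"
    using assms by (simp add: proj_smult)
  also have "c *s (mat_U *v phase_vec w l s) = mat_U *v phase_vec (c *s w) l s"
    unfolding vector_scalar_commute[symmetric] by (rule arg_cong[of _ _ "(*v) mat_U"]) (simp add: phase_vec_def vec_eq_iff)
  finally show ?thesis
    by (simp only: w_def l_def)
qed

text \<open>Matching phases with those in \<open>mat_R_eq\<close> forces \<theta>1 = (l3 - l1) s and
  \<theta>2 = -(l2 - l1) s, where (l1, l2, l3) = (\<open>e12\<close>, \<open>e13\<close>,
  \<open>e11\<close>).\<close>

lemma symm_config1_eq_mat_R:
  "symm_config1 r \<rho> s = act (mat_R (e13 r \<rho> * (1 + 2 * r) * s) (- (e13 r \<rho> * (2 + r)) * s)) (pt_S \<rho>)"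
proof -
  define M where "M = e13 r \<rho>"
  have e: "e11 r \<rho> = r * M" "e12 r \<rho> = - (1 + r) * M" "e13 r \<rho> = M"
    by (simp_all add: e11_def e12_def e13_def M_def)
  have angles: "(M * (1 + 2 * r) * s - - (M * (2 + r)) * s) / 3 = - (- (1 + r) * M * s)"
    "(M * (1 + 2 * r) * s + 2 * (- (M * (2 + r)) * s)) / 3 = - (M * s)"
    "(2 * (M * (1 + 2 * r) * s) + - (M * (2 + r)) * s) / 3 = r * M * s"
    by (simp_all add: algebra_simps)
  have "mat_U ** matrix_exp (s *\<^sub>R mat_D1 r \<rho>) ** matrix_inv mat_U =
      mat_R (e13 r \<rho> * (1 + 2 * r) * s) (- (e13 r \<rho> * (2 + r)) * s)"
    unfolding scaleR_mat_D1 matrix_exp_diag3 matrix_inv_U mat_R_eq e angles by simp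
  then show ?thesis
    by (simp only: symm_config1_def)
qed

theorem proposition4p5:
  fixes r \<rho> :: real
  assumes "(r, \<rho>) \<in> frakA" and "r \<in> \<rat>"
  shows "isoparametric_knot (symm_config1 r \<rho>)
    \<and> first_class (symm_config1 r \<rho>)
    \<and> has_spectral_ratio (symm_config1 r \<rho>) r
    \<and> (\<exists>p q :: int. p > 0 \<and> q < 0 \<and> coprime p q
         \<and> (2 + r) / (1 + 2 * r) = of_int p / of_int q
         \<and> negative_torus_knot \<rho> (range (symm_config1 r \<rho>)) p q)
    \<and> range (symm_config1 r \<rho>) \<subseteq> cyclide \<rho>"
proof -
  let ?\<gamma> = "symm_config1 r \<rho>"
  have r: "-2 < r" "r < -1/2" and \<rho>: "0 < \<rho>"
    using assms(1) by (auto simp: frakA_def)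
  define P where "P = 4 + 8 * r + 12 * \<rho>^2 + (1 + 2 * r) * \<rho>^4"
  define Q where "Q = (2 + 3 * r - 3 * r^2 - 2 * r^3) * (- 4 * \<rho> + \<rho>^5)"
  define h where "h = Q powr (1/3)"
  \<comment> \<open>The common factor mu1 / (1 - mu1) of the three frequencies, simplified.\<close>
  define M where "M = - P / (2 * h\<^sup>2)"
  \<comment> \<open>The solution of the two normalizations \<open>cM2\<close> (natural parameter)
    and \<open>cM3\<close> (Wilczynski). It is negative, as the value -1 of the determinant
    requires.\<close>
  define c where "c = 4 * h / P"
  have P: "P < 0" and Q: "Q > 0"
    using frakA_signs[OF assms(1)] by (simp_all add: P_def Q_def)
  \<comment> \<open>Positivity of \<open>Q\<close> makes the real power a genuine cube root.\<close>
  have h: "h > 0" "h ^ 3 = Q" "Q powr (2/3) = h\<^sup>2"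
    using Q by (simp_all add: h_def powr_powr flip: powr_numeral)
  have M: "M > 0" and c: "c \<noteq> 0"
    using P h by (simp_all add: M_def c_def divide_neg_pos)
  have cM2: "c\<^sup>2 * M * P = -8"
    using P h(1) by (simp add: c_def M_def field_simps power2_eq_square)
  have cM3: "c ^ 3 * M ^ 3 * Q = -8"
  proof -
    have "c * M = - 2 / h"
      using P h(1) by (simp add: c_def M_def field_simps power2_eq_square)
    then have "(c * M) ^ 3 * h ^ 3 = -8"
      using h(1) by (simp add: power_divide)
    then show ?thesis
      by (simp add: h(2) power_mult_distrib)
  qed
  have e: "e11 r \<rho> = r * M" "e12 r \<rho> = - (1 + r) * M" "e13 r \<rho> = M"
  proof -
    have D: "P - 2 * h\<^sup>2 \<noteq> 0"
      using P zero_le_power2[of h] by linarith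
    have \<mu>: "mu1 r \<rho> = P / (P - 2 * h\<^sup>2)"
      unfolding mu1_def P_def[symmetric] Q_def[symmetric] h(3) ..
    have "1 - mu1 r \<rho> = - (2 * h\<^sup>2) / (P - 2 * h\<^sup>2)"
      using D unfolding \<mu> by (simp add: field_simps)
    then show "e13 r \<rho> = M"
      using D h(1) by (simp add: e13_def M_def \<mu>)
    then show "e11 r \<rho> = r * M" "e12 r \<rho> = - (1 + r) * M"
      by (simp_all add: e11_def e12_def e13_def)
  qed
  define l :: "real^3" where "l = vector [- (1 + r) * M, M, r * M]"
  define b :: "complex^3" where
    "b = of_real c *s (mat_V *v vector [1, of_real \<rho>, \<i> * of_real (\<rho>\<^sup>2) / 2])"
  have \<gamma>: "?\<gamma> s = proj (mat_U *v phase_vec b l s)" for s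
    using symm_config1_eq_phase_orbit[of "of_real c" r \<rho> s] c by (simp add: b_def l_def e)
  have b_nth: "b $ 1 = of_real (c * (1 + \<rho>\<^sup>2 / 2) / sqrt 2)" "b $ 2 = of_real (c * \<rho>)"
    "b $ 3 = - \<i> * of_real (c * (1 - \<rho>\<^sup>2 / 2) / sqrt 2)"
    by (simp_all add: b_def mat_V_def matrix_vector_mult_def sum_3 field_simps)
  have b2: "(cmod (b $ 1))\<^sup>2 = c\<^sup>2 * (1 + \<rho>\<^sup>2 / 2)\<^sup>2 / 2" "(cmod (b $ 2))\<^sup>2 = c\<^sup>2 * \<rho>\<^sup>2"
    "(cmod (b $ 3))\<^sup>2 = c\<^sup>2 * (1 - \<rho>\<^sup>2 / 2)\<^sup>2 / 2"
    by (simp_all only: b_nth norm_mult norm_of_real norm_minus_cancel norm_ii mult_1 power2_abs)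
      (simp_all add: power_mult_distrib power_divide)
  define \<kappa> where "\<kappa> = c\<^sup>2 * M\<^sup>2 * (\<rho>\<^sup>2 * (4 - 8 * r - 8 * r\<^sup>2) - (1 + 2 * r) * (4 + \<rho>^4)) / 16"
  \<comment> \<open>The subtracted term is minus the second elementary symmetric function of the
    frequencies.\<close>
  define \<tau> where "\<tau> = 3 * \<kappa>\<^sup>2 - M\<^sup>2 * (1 + r + r\<^sup>2)"
  have iso: "isoparametric ?\<gamma> \<kappa> \<tau>"
    and eig: "eigenvalues (mat_H \<kappa> \<tau>) = {of_real (l $ 1), of_real (l $ 2), of_real (l $ 3)}"
  proof (atomize (full), rule conjI)
    have sum0: "l $ 1 + l $ 2 + l $ 3 = 0"
      by (simp add: l_def algebra_simps)
    have m0: "- (cmod (b $ 1))\<^sup>2 + (cmod (b $ 2))\<^sup>2 + (cmod (b $ 3))\<^sup>2 = 0"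
      unfolding b2 by (simp add: power2_eq_square field_simps)
    have "- (cmod (b $ 1))\<^sup>2 * l $ 1 + (cmod (b $ 2))\<^sup>2 * l $ 2 + (cmod (b $ 3))\<^sup>2 * l $ 3 = c\<^sup>2 * M * P / 8"
      unfolding b2 by (simp add: l_def P_def power2_eq_square power4_eq_xxxx field_simps)
    then have m1: "- (cmod (b $ 1))\<^sup>2 * l $ 1 + (cmod (b $ 2))\<^sup>2 * l $ 2 + (cmod (b $ 3))\<^sup>2 * l $ 3 = -1"
      using cM2 by simp
    have m2: "- (cmod (b $ 1))\<^sup>2 * (l $ 1)\<^sup>2 + (cmod (b $ 2))\<^sup>2 * (l $ 2)\<^sup>2 + (cmod (b $ 3))\<^sup>2 * (l $ 3)\<^sup>2 = 2 * \<kappa>"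
      unfolding b2 by (simp add: l_def \<kappa>_def power2_eq_square power4_eq_xxxx field_simps)
    have \<tau>: "\<tau> = l $ 1 * l $ 2 + l $ 1 * l $ 3 + l $ 2 * l $ 3 + 3 * \<kappa>\<^sup>2"
      by (simp add: \<tau>_def l_def power2_eq_square algebra_simps)
    have "(1 + \<rho>\<^sup>2 / 2) / sqrt 2 * ((1 - \<rho>\<^sup>2 / 2) / sqrt 2) = (4 - \<rho>^4) / 8"
      by (simp add: power2_eq_square power4_eq_xxxx field_simps)
    then have "c * (1 + \<rho>\<^sup>2 / 2) / sqrt 2 * (c * \<rho>) * (c * (1 - \<rho>\<^sup>2 / 2) / sqrt 2) *
        ((l $ 2 - l $ 1) * (l $ 3 - l $ 1) * (l $ 3 - l $ 2)) =
        c ^ 3 * \<rho> * ((4 - \<rho>^4) / 8) * ((l $ 2 - l $ 1) * (l $ 3 - l $ 1) * (l $ 3 - l $ 2))"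
      by (simp add: power3_eq_cube)
    also have "\<dots> = c ^ 3 * M ^ 3 * Q / 8"
      by (simp add: l_def Q_def eval_nat_numeral field_simps)
    finally have real_det: "c * (1 + \<rho>\<^sup>2 / 2) / sqrt 2 * (c * \<rho>) * (c * (1 - \<rho>\<^sup>2 / 2) / sqrt 2) *
        ((l $ 2 - l $ 1) * (l $ 3 - l $ 1) * (l $ 3 - l $ 2)) = -1"
      using cM3 by simp
    \<comment> \<open>The factor -i of \<open>b $ 3\<close> absorbs the \<open>\<i>\<close> of the
      Vandermonde formula, so the determinant is real.\<close>
    have i: "\<i> * x * y * (- \<i> * z) * v = x * y * z * v" for x y z v :: complex
      by (simp add: algebra_simps)
    have det: "\<i> * b $ 1 * b $ 2 * b $ 3 * of_real ((l $ 2 - l $ 1) * (l $ 3 - l $ 1) * (l $ 3 - l $ 2)) = -1"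
      unfolding b_nth i of_real_mult[symmetric] real_det by simp
    show "isoparametric ?\<gamma> \<kappa> \<tau>"
      by (rule phase_orbit_moments(1)[OF \<gamma> sum0 m0 m1 det m2 \<tau>])
    show "eigenvalues (mat_H \<kappa> \<tau>) = {of_real (l $ 1), of_real (l $ 2), of_real (l $ 3)}"
      by (rule phase_orbit_moments(2)[OF \<gamma> sum0 m0 m1 det m2 \<tau>])
  qed
  have "(2 + r) / (1 + 2 * r) \<in> \<rat>"
    using assms(2) by simp
  then obtain u v :: int where uv: "v > 0" "coprime u v" "(2 + r) / (1 + 2 * r) = of_int u / of_int v"
    by (rule Rats_cases')
  \<comment> \<open>The reduced fraction comes with a positive denominator, so both signs are
    flipped to get \<open>q < 0\<close>. The unit \<open>g\<close> makes the frequency differences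
    \<open>p g\<close> and \<open>q g\<close>; it is positive because \<open>1 + 2 * r\<close> and
    \<open>q\<close> are both negative.\<close>
  define p q g where "p = - u" and "q = - v" and "g = M * (1 + 2 * r) / of_int q"
  have "(2 + r) / (1 + 2 * r) < 0"
    using r by (simp add: divide_pos_neg)
  with uv have pq: "p > 0" "q < 0" "coprime p q" "(2 + r) / (1 + 2 * r) = of_int p / of_int q"
    by (auto simp: p_def q_def divide_less_0_iff)
  have g: "g > 0"
    using M r pq(2) by (simp add: g_def divide_neg_neg mult_pos_neg)
  have l: "l $ 2 - l $ 1 = of_int p * g" "l $ 3 - l $ 1 = of_int q * g"
  proof -
    show "l $ 3 - l $ 1 = of_int q * g"
      using pq(2) by (simp add: g_def l_def) (simp add: algebra_simps)
    have "of_int p * g = M * (1 + 2 * r) * ((2 + r) / (1 + 2 * r))"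
      unfolding pq(4) by (simp add: g_def)
    then show "l $ 2 - l $ 1 = of_int p * g"
      using r by (simp add: l_def) (simp add: algebra_simps)
  qed
  have "b $ j \<noteq> 0" for j
  proof -
    \<comment> \<open>The coordinate \<open>b $ 3\<close> would vanish only for \<rho>^2 = 2, which
      \<open>Q > 0\<close> excludes.\<close>
    have "- 4 * \<rho> + \<rho>^5 = \<rho> * (\<rho>\<^sup>2 / 2 - 1) * (\<rho>\<^sup>2 + 2) * 2"
      by (simp add: eval_nat_numeral field_simps)
    then have "\<rho>\<^sup>2 / 2 \<noteq> 1"
      using Q by (auto simp: Q_def)
    moreover have "1 + \<rho>\<^sup>2 / 2 \<noteq> 0"
      using zero_le_power2[of \<rho>] by linarith
    ultimately show ?thesis
      using exhaust_3[of j] c \<rho> by (auto simp: b_nth simp del: of_real_add of_real_diff of_real_mult of_real_divide)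
  qed
  then have simple: "simple_closed ?\<gamma>"
    by (rule simple_closed_phase_orbit[OF \<gamma> _ g pq(3) l])
  then have string: "isoparametric_string ?\<gamma>"
    using iso unfolding isoparametric_string_def simple_closed_def minimal_period_def by blast
  have "first_class ?\<gamma>"
  proof -
    have "2 * \<kappa> * P = (c\<^sup>2 * M * P) * (M * (\<rho>\<^sup>2 * (4 - 8 * r - 8 * r\<^sup>2) - (1 + 2 * r) * (4 + \<rho>^4))) / 8"
      by (simp add: \<kappa>_def power2_eq_square)
    also have "\<dots> = - (M * (\<rho>\<^sup>2 * (4 - 8 * r - 8 * r\<^sup>2) - (1 + 2 * r) * (4 + \<rho>^4)))"
      unfolding cM2 by simp
    finally have "3 * \<kappa> > sqrt \<bar>\<tau>\<bar>"
      unfolding \<tau>_def using P unfolding P_def by (intro first_class_inequality[OF r \<rho> M])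
    then show ?thesis
      using string iso unfolding first_class_def by blast
  qed
  moreover have "has_spectral_ratio ?\<gamma> r"
    unfolding has_spectral_ratio_def
  proof (intro conjI exI)
    show "isoparametric ?\<gamma> \<kappa> \<tau>" "isoparametric_string ?\<gamma>"
      by fact+
    \<comment> \<open>The two orderings are exactly r < -1/2 and r > -2.\<close>
    show "r * M < - (1 + r) * M" "- (1 + r) * M < M"
      using r mult_strict_right_mono[OF _ M, of r "- (1 + r)"] mult_strict_right_mono[OF _ M, of "- (1 + r)" 1]
      by simp_all
    show "eigenvalues (mat_H \<kappa> \<tau>) = {of_real (r * M), of_real (- (1 + r) * M), of_real M}"
      unfolding eig by (auto simp: l_def)
    show "r = r * M / M"
      using M by simp
  qed
  moreover have mat_R: "?\<gamma> s = act (mat_R (M * (1 + 2 * r) * s + 0) (- (M * (2 + r)) * s + 0)) (pt_S \<rho>)" for s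
    using symm_config1_eq_mat_R[of r \<rho> s] by (simp add: e)
  moreover have "negative_torus_knot \<rho> (range ?\<gamma>) p q"
  proof -
    have "torus_knot_param \<rho> ?\<gamma> p q"
      unfolding torus_knot_param_def
    proof (intro conjI exI allI)
      show "M * (1 + 2 * r) \<noteq> 0"
        using M r by simp
      show "of_int p / of_int q = - (- (M * (2 + r))) / (M * (1 + 2 * r))"
        using M pq(4) by simp
      show "?\<gamma> s = act (mat_R (M * (1 + 2 * r) * s + 0) (- (M * (2 + r)) * s + 0)) (pt_S \<rho>)" for s
        by (rule mat_R)
    qed (use simple pq in simp_all)
    then show ?thesis
      using pq by (auto simp: negative_torus_knot_def torus_knot_def mult_pos_neg)
  qed
  moreover have "range ?\<gamma> \<subseteq> cyclide \<rho>"
    using mat_R by (auto simp: cyclide_def)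
  ultimately show ?thesis
    using string simple pq unfolding isoparametric_knot_def by blast
qed

end
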